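(* (i) For every (possibly randomized) algorithm $A$ in the oblivious query commit model there is a fully randomized priority algorithm $B$ in the vertex model such that on every input graph $B$ outputs a matching with the same distribution as $A$; in particular this holds for every vertex iterative algorithm. (ii) MinGreedy cannot be implemented in the oblivious query commit model: there is no algorithm in that model whose output matching has, on every input graph, the same distribution as the output of MinGreedy.
   Context: Input: a finite simple graph $G$ whose node identifiers come from a set known in advance. Oblivious query commit model: edges are not revealed; the (possibly randomized) algorithm repeatedly chooses a pair $\{x,y\}$ of not yet matched nodes and probes it; if $\{x,y\}$ is an edge of $G$, it is irrevocably added to the matching and both nodes become matched. A vertex iterative algorithm is such an algorithm that in each round picks a random unmatched vertex $u$ and scans (a subset of) the other vertices one after another, probing adjacency to $u$ (the first edge found is added to the matching, ending the round); before every probe it may instead isolate $u$ irrevocably and skip to the next round. Vertex model: the data item of node $u$ with neighbors $v_1,\dots,v_d$ is $\langle u;v_1,\dots,v_d\rangle$. A fully randomized priority algorithm proceeds in rounds; in each round it (possibly randomly, as a function of information received so far) chooses a total order on all possible data items, receives the first data item of the input whose node $u$ is neither matched nor isolated, and irrevocably (possibly randomly) either matches $u$ to an available neighbor or isolates $u$. MinGreedy: while edges remain, pick a node $u$ uniformly at random among non-isolated nodes of minimum current degree, match it to a uniformly random current neighbor, and delete both nodes with their incident edges. *)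

theory Defs
  imports "HOL-Probability.Probability"
begin

section \<open>Graphs\<close>

text \<open>The type \<open>'v\<close> is the set of node identifiers known in advance; it may be infinite. An edge is
  a two-element set, and a matching is a set of edges.\<close>

record 'v graph =
  verts :: "'v set"
  edges :: "'v set set"

definition simple_graph :: "'v graph \<Rightarrow> bool" where
  "simple_graph G \<longleftrightarrow> finite (verts G) \<and> edges G \<subseteq> {e. e \<subseteq> verts G \<and> card e = 2}"

definition neighbors :: "'v graph \<Rightarrow> 'v \<Rightarrow> 'v set" where
  "neighbors G u = {v. {u, v} \<in> edges G}"

definition node_degree :: "'v graph \<Rightarrow> 'v \<Rightarrow> nat" where
  "node_degree G u = card (neighbors G u)"

definition delete_nodes :: "'v set \<Rightarrow> 'v graph \<Rightarrow> 'v graph" where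
  "delete_nodes W G = \<lparr>verts = verts G - W, edges = {e \<in> edges G. e \<inter> W = {}}\<rparr>"


section \<open>Randomized algorithms\<close>

text \<open>
  A randomized algorithm of a given kind is a family of deterministic algorithms of that kind, indexed
  by a random seed: \<open>A r\<close> is the algorithm obtained when all random choices are resolved by \<open>r\<close>.
  The seed space \<open>M\<close> is an arbitrary probability space. The output has to be a random variable on
  every input, so that its distribution is defined.
\<close>

definition randomized ::
    "('c \<Rightarrow> bool) \<Rightarrow> ('c \<Rightarrow> 'v graph \<Rightarrow> 'v set set) \<Rightarrow> 'r measure \<Rightarrow> ('r \<Rightarrow> 'c) \<Rightarrow> bool" where
  "randomized legal out M A \<longleftrightarrow>
     prob_space M \<and> (\<forall>r\<in>space M. legal (A r)) \<and>
     (\<forall>G. simple_graph G \<longrightarrow> (\<lambda>r. out (A r) G) \<in> measurable M (count_space UNIV))"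

definition output_distribution ::
    "('c \<Rightarrow> 'v graph \<Rightarrow> 'v set set) \<Rightarrow> 'r measure \<Rightarrow> ('r \<Rightarrow> 'c) \<Rightarrow> 'v graph \<Rightarrow> 'v set set measure" where
  "output_distribution out M A G = distr M (count_space UNIV) (\<lambda>r. out (A r) G)"


section \<open>The oblivious query commit model\<close>

text \<open>A transcript lists the probed pairs together with the answers. From the transcript a
  (deterministic) algorithm determines the next pair to probe, or \<open>None\<close> to halt.\<close>

type_synonym 'v transcript = "('v set \<times> bool) list"
type_synonym 'v query_algorithm = "'v transcript \<Rightarrow> 'v set option"

definition committed :: "'v transcript \<Rightarrow> 'v set set" where
  "committed h = {e. (e, True) \<in> set h}"

definition query_legal :: "'v query_algorithm \<Rightarrow> bool" where
  "query_legal A \<longleftrightarrow> (\<forall>h e. A h = Some e \<longrightarrow> card e = 2 \<and> e \<inter> \<Union>(committed h) = {})"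

primrec query_run :: "'v query_algorithm \<Rightarrow> 'v graph \<Rightarrow> nat \<Rightarrow> 'v transcript" where
  "query_run A G 0 = []"
| "query_run A G (Suc n) =
     (let h = query_run A G n in
      case A h of None \<Rightarrow> h | Some e \<Rightarrow> h @ [(e, e \<in> edges G)])"

text \<open>Committed edges are never revoked, so the output is the union over all steps. This is the final
  matching if the algorithm halts; algorithms that keep re-probing non-edges are admitted too.\<close>

definition query_output :: "'v query_algorithm \<Rightarrow> 'v graph \<Rightarrow> 'v set set" where
  "query_output A G = (\<Union>n. committed (query_run A G n))"

abbreviation randomized_query :: "'r measure \<Rightarrow> ('r \<Rightarrow> 'v query_algorithm) \<Rightarrow> bool" where
  "randomized_query \<equiv> randomized query_legal query_output"


section \<open>Vertex iterative algorithms\<close>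

text \<open>\<open>Pick u\<close> opens a round for \<open>u\<close>, \<open>Scan v\<close> probes \<open>v\<close> with the current vertex, and \<open>Isolate\<close>
  isolates the current vertex and closes the round. The history records each move with the answer
  obtained, which is \<open>False\<close> for moves that do not probe.\<close>

datatype 'v vi_move = Pick 'v | Scan 'v | Isolate

type_synonym 'v vi_history = "('v vi_move \<times> bool) list"
type_synonym 'v vi_algorithm = "'v vi_history \<Rightarrow> 'v vi_move option"

record 'v vi_state =
  current :: "'v option"
  matching :: "'v set set"
  isolated :: "'v set"

fun vi_update :: "'v vi_move \<times> bool \<Rightarrow> 'v vi_state \<Rightarrow> 'v vi_state" where
  "vi_update (Pick u, b) s = s\<lparr>current := Some u\<rparr>"
| "vi_update (Scan v, b) s =
     (if b then s\<lparr>current := None, matching := insert {the (current s), v} (matching s)\<rparr> else s)"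
| "vi_update (Isolate, b) s =
     s\<lparr>current := None, isolated := insert (the (current s)) (isolated s)\<rparr>"

definition vi_state :: "'v vi_history \<Rightarrow> 'v vi_state" where
  "vi_state h = fold vi_update h \<lparr>current = None, matching = {}, isolated = {}\<rparr>"

definition vi_taken :: "'v vi_state \<Rightarrow> 'v set" where
  "vi_taken s = \<Union>(matching s) \<union> isolated s"

text \<open>\<open>Pick\<close> does not require the previous round to be closed: if the scan of a vertex is over without
  success, the vertex need not be isolated.\<close>

fun vi_legal_move :: "'v vi_state \<Rightarrow> 'v vi_move \<Rightarrow> bool" where
  "vi_legal_move s (Pick u) \<longleftrightarrow> u \<notin> vi_taken s"
| "vi_legal_move s (Scan v) \<longleftrightarrow> (\<exists>u. current s = Some u \<and> v \<noteq> u) \<and> v \<notin> vi_taken s"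
| "vi_legal_move s Isolate \<longleftrightarrow> current s \<noteq> None"

definition vi_legal :: "'v vi_algorithm \<Rightarrow> bool" where
  "vi_legal A \<longleftrightarrow> (\<forall>h m. A h = Some m \<longrightarrow> vi_legal_move (vi_state h) m)"

fun vi_answer :: "'v vi_state \<Rightarrow> 'v graph \<Rightarrow> 'v vi_move \<Rightarrow> bool" where
  "vi_answer s G (Scan v) \<longleftrightarrow> {the (current s), v} \<in> edges G"
| "vi_answer s G _ \<longleftrightarrow> False"

primrec vi_run :: "'v vi_algorithm \<Rightarrow> 'v graph \<Rightarrow> nat \<Rightarrow> 'v vi_history" where
  "vi_run A G 0 = []"
| "vi_run A G (Suc n) =
     (let h = vi_run A G n in
      case A h of None \<Rightarrow> h | Some m \<Rightarrow> h @ [(m, vi_answer (vi_state h) G m)])"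

definition vi_output :: "'v vi_algorithm \<Rightarrow> 'v graph \<Rightarrow> 'v set set" where
  "vi_output A G = (\<Union>n. matching (vi_state (vi_run A G n)))"

abbreviation randomized_vi :: "'r measure \<Rightarrow> ('r \<Rightarrow> 'v vi_algorithm) \<Rightarrow> bool" where
  "randomized_vi \<equiv> randomized vi_legal vi_output"


section \<open>Fully randomized priority algorithms in the vertex model\<close>

text \<open>The data item of a node \<open>u\<close> consists of \<open>u\<close> and all its neighbors in the input graph.\<close>

type_synonym 'v item = "'v \<times> 'v set"

definition data_items :: "'v item set" where
  "data_items = {(u, N). finite N \<and> u \<notin> N}"

text \<open>A decision \<open>Some v\<close> matches the node of the received item to \<open>v\<close>, and \<open>None\<close> isolates it.\<close>

type_synonym 'v priority_history = "('v item \<times> 'v option) list"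

record 'v priority_algorithm =
  ordering :: "'v priority_history \<Rightarrow> 'v item rel"
  decision :: "'v priority_history \<Rightarrow> 'v item \<Rightarrow> 'v option"

text \<open>The nodes that are already matched or isolated.\<close>

definition taken :: "'v priority_history \<Rightarrow> 'v set" where
  "taken h = (\<Union>((u, N), d)\<in>set h. insert u (set_option d))"

definition priority_legal :: "'v priority_algorithm \<Rightarrow> bool" where
  "priority_legal B \<longleftrightarrow>
     (\<forall>h. linear_order_on data_items (ordering B h)) \<and>
     (\<forall>h u N v. decision B h (u, N) = Some v \<longrightarrow> v \<in> N \<and> v \<notin> taken h)"

definition available_items :: "'v graph \<Rightarrow> 'v priority_history \<Rightarrow> 'v item set" where
  "available_items G h = {(u, neighbors G u) | u. u \<in> verts G \<and> u \<notin> taken h}"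

definition first_item :: "'v item rel \<Rightarrow> 'v item set \<Rightarrow> 'v item" where
  "first_item R S = (THE i. i \<in> S \<and> (\<forall>j\<in>S. (i, j) \<in> R))"

primrec priority_run :: "'v priority_algorithm \<Rightarrow> 'v graph \<Rightarrow> nat \<Rightarrow> 'v priority_history" where
  "priority_run B G 0 = []"
| "priority_run B G (Suc n) =
     (let h = priority_run B G n; S = available_items G h in
      if S = {} then h
      else (let i = first_item (ordering B h) S in h @ [(i, decision B h i)]))"

text \<open>Every round removes a node, so the union is reached after \<open>card (verts G)\<close> rounds.\<close>

definition priority_output :: "'v priority_algorithm \<Rightarrow> 'v graph \<Rightarrow> 'v set set" where
  "priority_output B G =
     (\<Union>n. {{u, v} | u N v. ((u, N), Some v) \<in> set (priority_run B G n)})"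

abbreviation randomized_priority :: "'r measure \<Rightarrow> ('r \<Rightarrow> 'v priority_algorithm) \<Rightarrow> bool" where
  "randomized_priority \<equiv> randomized priority_legal priority_output"


section \<open>MinGreedy\<close>

text \<open>In a simple graph the non-isolated nodes are those in \<open>\<Union>(edges G)\<close>.\<close>

definition min_degree_nodes :: "'v graph \<Rightarrow> 'v set" where
  "min_degree_nodes G = {u \<in> \<Union>(edges G). \<forall>w \<in> \<Union>(edges G). node_degree G u \<le> node_degree G w}"

lemma simple_graph_finite_edges: "simple_graph G \<Longrightarrow> finite (edges G)"
  unfolding simple_graph_def by (rule finite_subset[of _ "Pow (verts G)"]) auto

lemma simple_graph_finite_nodes:
  assumes "simple_graph G"
  shows "finite (\<Union>(edges G))"
  using assms unfolding simple_graph_def by (auto intro: finite_subset[of _ "verts G"])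

lemma min_degree_nodes_finite_nonempty:
  assumes G: "simple_graph G" and ne: "edges G \<noteq> {}"
  shows "finite (min_degree_nodes G)" "min_degree_nodes G \<noteq> {}"
proof -
  show "finite (min_degree_nodes G)"
    by (rule finite_subset[OF _ simple_graph_finite_nodes[OF G]]) (auto simp: min_degree_nodes_def)
  from G ne obtain e where e: "e \<in> edges G" "card e = 2"
    unfolding simple_graph_def by blast
  then have "e \<noteq> {}" by auto
  with e obtain u where "u \<in> \<Union>(edges G)" by blast
  then obtain w where "w \<in> \<Union>(edges G) \<and> (\<forall>y. y \<in> \<Union>(edges G) \<longrightarrow> node_degree G w \<le> node_degree G y)"
    using ex_has_least_nat[of "\<lambda>u. u \<in> \<Union>(edges G)" u "node_degree G"] by blast
  then show "min_degree_nodes G \<noteq> {}"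
    unfolding min_degree_nodes_def by blast
qed

lemma neighbors_finite_nonempty:
  assumes G: "simple_graph G" and u: "u \<in> \<Union>(edges G)"
  shows "finite (neighbors G u)" "neighbors G u \<noteq> {}"
proof -
  show "finite (neighbors G u)"
    by (rule finite_subset[OF _ simple_graph_finite_nodes[OF G]]) (auto simp: neighbors_def)
  from u obtain e where e: "e \<in> edges G" "u \<in> e" by blast
  with G have "card e = 2" unfolding simple_graph_def by blast
  then obtain x y where xy: "e = {x, y}" by (meson card_2_iff)
  with e have "{u, x} \<in> edges G \<or> {u, y} \<in> edges G" by (metis insert_commute insertE singletonD)
  then show "neighbors G u \<noteq> {}" unfolding neighbors_def by blast
qed

function mingreedy :: "'v graph \<Rightarrow> 'v set set pmf" where
  "mingreedy G =
     (if simple_graph G \<and> edges G \<noteq> {} then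
        bind_pmf (pmf_of_set (min_degree_nodes G)) (\<lambda>u.
        bind_pmf (pmf_of_set (neighbors G u)) (\<lambda>v.
        map_pmf (insert {u, v}) (mingreedy (delete_nodes {u, v} G))))
      else return_pmf {})"
  by pat_completeness auto
termination
proof (relation "Wellfounded.measure (\<lambda>G. card (edges G))", rule wf_measure)
  fix G :: "'v graph" and u v
  assume G: "simple_graph G \<and> edges G \<noteq> {}"
    and u: "u \<in> set_pmf (pmf_of_set (min_degree_nodes G))"
    and v: "v \<in> set_pmf (pmf_of_set (neighbors G u))"
  have "u \<in> min_degree_nodes G"
    using u set_pmf_of_set[OF min_degree_nodes_finite_nonempty(2,1)] G by blast
  then have "u \<in> \<Union>(edges G)" unfolding min_degree_nodes_def by blast
  then have "set_pmf (pmf_of_set (neighbors G u)) = neighbors G u"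
    using G neighbors_finite_nonempty[of G u] by (intro set_pmf_of_set) blast+
  with v have "v \<in> neighbors G u" by (simp only:)
  then have "{u, v} \<in> edges G" unfolding neighbors_def by simp
  then have "edges (delete_nodes {u, v} G) \<subset> edges G"
    unfolding delete_nodes_def by fastforce
  then have "card (edges (delete_nodes {u, v} G)) < card (edges G)"
    using G by (intro psubset_card_mono simple_graph_finite_edges) auto
  then show "(delete_nodes {u, v} G, G) \<in> Wellfounded.measure (\<lambda>G. card (edges G))"
    by (simp only: in_measure)
qed

declare mingreedy.simps [simp del]

end

theory Submission
  imports Defs
begin

text \<open>
  Both query models are instances of a process that, run on an edge set \<open>E\<close>, probes the pair
  \<open>P E k\<close> in step \<open>k\<close>. As long as the matched edges \<open>M\<close> are the only successful probes, running the
  process on \<open>G\<close> and on the edge set \<open>M\<close> gives the same probes. So the matched edges are all the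
  priority algorithm has to know: it ranks a data item by the first step in which the process on
  \<open>M\<close> probes an edge of that item outside \<open>M\<close>. The first item of finite rank then exhibits the next
  edge that the process commits on \<open>G\<close>; an item of infinite rank comes first only if the process will
  commit no further edge.

  For the separation, MinGreedy never selects the middle edge \<open>bc\<close> of a path \<open>abcd\<close>. A query
  algorithm has to fix its first probe \<open>bc\<close> inside the node set before it has any information, and it
  is wrong on the path that has \<open>bc\<close> in the middle.
\<close>

section \<open>First items\<close>

text \<open>Ranks may tie, while a priority algorithm must supply a total order. A linear order
  \<open>W\<close> of the whole type settles equal ranks.\<close>

lemma linear_order_on_rank_tiebreak:
  fixes f :: "'a \<Rightarrow> 'b :: linorder"
  assumes W: "linear_order_on UNIV W"
  shows "linear_order_on D {(i, j). i \<in> D \<and> j \<in> D \<and> (f i < f j \<or> f i = f j \<and> (i, j) \<in> W)}"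
proof -
  have W_refl: "(i, i) \<in> W" and W_total: "i \<noteq> j \<Longrightarrow> (i, j) \<in> W \<or> (j, i) \<in> W"
    and W_antisym: "(i, j) \<in> W \<Longrightarrow> (j, i) \<in> W \<Longrightarrow> i = j"
    and W_trans: "(i, j) \<in> W \<Longrightarrow> (j, k) \<in> W \<Longrightarrow> (i, k) \<in> W" for i j k
    using W unfolding linear_order_on_def partial_order_on_def preorder_on_def total_on_def
      antisym_def trans_def refl_on_def by blast+
  show ?thesis
    unfolding linear_order_on_def partial_order_on_def preorder_on_def
    by (auto intro!: refl_onI transI antisymI total_onI intro: W_refl W_trans
        dest: W_antisym W_total less_trans)
qed

lemma first_item:
  assumes R: "linear_order_on D R" and S: "finite S" "S \<noteq> {}" "S \<subseteq> D"
  shows "first_item R S \<in> S" "\<And>j. j \<in> S \<Longrightarrow> (first_item R S, j) \<in> R"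
proof -
  have R_refl: "i \<in> D \<Longrightarrow> (i, i) \<in> R"
    and R_total: "i \<in> D \<Longrightarrow> j \<in> D \<Longrightarrow> i \<noteq> j \<Longrightarrow> (i, j) \<in> R \<or> (j, i) \<in> R"
    and R_antisym: "(i, j) \<in> R \<Longrightarrow> (j, i) \<in> R \<Longrightarrow> i = j"
    and R_trans: "(i, j) \<in> R \<Longrightarrow> (j, k) \<in> R \<Longrightarrow> (i, k) \<in> R" for i j k
    using R unfolding linear_order_on_def partial_order_on_def preorder_on_def total_on_def
      antisym_def trans_def refl_on_def by blast+
  have "\<exists>i\<in>S. \<forall>j\<in>S. (i, j) \<in> R"
    using S
  proof (induction S rule: finite_ne_induct)
    case (singleton x)
    then show ?case using R_refl by auto
  next
    case (insert x F)
    then obtain i where i: "i \<in> F" "\<forall>j\<in>F. (i, j) \<in> R" by auto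
    show ?case
    proof (cases "(i, x) \<in> R")
      case True
      with i show ?thesis by auto
    next
      case False
      with i insert.prems R_total R_refl have "(x, i) \<in> R" "(x, x) \<in> R" by (metis insert_subset subsetD)+
      with i R_trans show ?thesis by blast
    qed
  qed
  then have "\<exists>!i. i \<in> S \<and> (\<forall>j\<in>S. (i, j) \<in> R)"
    using R_antisym by blast
  from theI'[OF this] show "first_item R S \<in> S" "\<And>j. j \<in> S \<Longrightarrow> (first_item R S, j) \<in> R"
    unfolding first_item_def by blast+
qed

section \<open>Probe processes\<close>

text \<open>\<open>locality\<close> says that only the answers to earlier probes can influence the
  next one. Steps run through all naturals, and \<open>None\<close> may be a silent step as well as
  a halted run.\<close>

locale probe_process =
  fixes P :: "'v set set \<Rightarrow> nat \<Rightarrow> 'v set option"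
  assumes locality:
      "(\<And>j e. j < k \<Longrightarrow> P E j = Some e \<Longrightarrow> e \<in> E \<longleftrightarrow> e \<in> F) \<Longrightarrow> P E k = P F k"
    and card_probe: "P E k = Some e \<Longrightarrow> card e = 2"
    and probe_disjoint: "P E k = Some e \<Longrightarrow> j < k \<Longrightarrow> P E j = Some e' \<Longrightarrow> e' \<in> E \<Longrightarrow> e \<inter> e' = {}"
begin

definition commits :: "'v set set \<Rightarrow> nat \<Rightarrow> 'v set set" where
  "commits E k = {e \<in> E. \<exists>j<k. P E j = Some e}"

definition result :: "'v set set \<Rightarrow> 'v set set" where
  "result E = {e \<in> E. \<exists>j. P E j = Some e}"

lemma commits_subset_result: "commits E k \<subseteq> result E"
  unfolding commits_def result_def by blast

lemma result_disjoint:
  assumes "e \<in> result E" "e' \<in> result E" "e \<noteq> e'"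
  shows "e \<inter> e' = {}"
proof -
  from assms obtain j j' where j: "P E j = Some e" "e \<in> E" "P E j' = Some e'" "e' \<in> E"
    unfolding result_def by blast
  with assms(3) have "j < j' \<or> j' < j" by (metis nat_neq_iff option.inject)
  then show ?thesis using probe_disjoint[of E j e j' e'] probe_disjoint[of E j' e' j e] j by auto
qed

section \<open>The simulating priority algorithm\<close>

definition matched_edges :: "'v priority_history \<Rightarrow> 'v set set" where
  "matched_edges h = {{u, v} | u N v. ((u, N), Some v) \<in> set h}"

definition hit :: "'v set set \<Rightarrow> 'v item \<Rightarrow> nat \<Rightarrow> bool" where
  "hit M i k \<longleftrightarrow> (\<exists>v \<in> snd i. P M k = Some {fst i, v} \<and> {fst i, v} \<notin> M)"

definition hit_rank :: "'v set set \<Rightarrow> 'v item \<Rightarrow> enat" where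
  "hit_rank M i = (if \<exists>k. hit M i k then enat (LEAST k. hit M i k) else \<infinity>)"

lemma hit_rank_eq_enatD: "hit_rank M i = enat k \<Longrightarrow> hit M i k"
  unfolding hit_rank_def using LeastI_ex[of "hit M i"] by (auto split: if_splits)

lemma hit_rank_le: "hit M i k \<Longrightarrow> hit_rank M i \<le> enat k"
  unfolding hit_rank_def using Least_le[of "hit M i" k] by auto

text \<open>The conditions \<open>v \<in> snd i\<close> and \<open>v \<notin> taken h\<close> are
  built in because legality quantifies over all histories and items, including those that no run
  produces.\<close>

definition partner :: "'v priority_history \<Rightarrow> 'v item \<Rightarrow> 'v \<Rightarrow> bool" where
  "partner h i v \<longleftrightarrow> v \<in> snd i \<and> v \<notin> taken h \<and>
     (\<exists>k. hit_rank (matched_edges h) i = enat k \<and> P (matched_edges h) k = Some {fst i, v})"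

text \<open>Ties of rank may be broken by any linear order; choice provides one for an arbitrary,
  possibly infinite, type of identifiers.\<close>

definition simulation :: "'v priority_algorithm" where
  "simulation = \<lparr>
     ordering = (\<lambda>h. {(i, j). i \<in> data_items \<and> j \<in> data_items \<and>
       (hit_rank (matched_edges h) i < hit_rank (matched_edges h) j \<or>
        hit_rank (matched_edges h) i = hit_rank (matched_edges h) j \<and>
        (i, j) \<in> (SOME W. well_order_on UNIV W))}),
     decision = (\<lambda>h i. if \<exists>v. partner h i v then Some (SOME v. partner h i v) else None)\<rparr>"

lemma linear_order_simulation: "linear_order_on data_items (ordering simulation h)"
proof -
  have "linear_order_on UNIV (SOME W. well_order_on (UNIV :: 'v item set) W)"
    using someI_ex[OF well_order_on] unfolding well_order_on_def by blast
  from linear_order_on_rank_tiebreak[OF this] show ?thesis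
    unfolding simulation_def by simp
qed

lemma decision_simulation_SomeD: "decision simulation h i = Some v \<Longrightarrow> partner h i v"
  unfolding simulation_def using someI_ex[of "partner h i"] by (auto split: if_splits)

lemma priority_legal_simulation: "priority_legal simulation"
  unfolding priority_legal_def
  using linear_order_simulation decision_simulation_SomeD by (fastforce simp: partner_def)

section \<open>Correctness of the simulation on a fixed graph\<close>

context
  fixes G :: "'v graph"
  assumes G: "simple_graph G"
begin

text \<open>Nodes are isolated only once the process commits nothing more.\<close>

definition simulates :: "'v priority_history \<Rightarrow> bool" where
  "simulates h \<longleftrightarrow> (\<exists>k. matched_edges h = commits (edges G) k) \<and>
     (taken h = \<Union>(matched_edges h) \<or> matched_edges h = result (edges G))"

text \<open>An edge yet to be committed excludes the second alternative of \<open>simulates\<close>,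
  so only matched nodes are taken. All of them were matched before step \<open>j\<close>, and later
  probes avoid them.\<close>

lemma edge_in_result_untaken:
  assumes "simulates h" "P (edges G) j = Some e" "e \<in> edges G" "e \<notin> matched_edges h"
  shows "e \<inter> taken h = {}" "commits (edges G) j \<supseteq> matched_edges h"
proof -
  have "e \<in> result (edges G)" using assms(2,3) unfolding result_def by blast
  with assms(1,4) have taken: "taken h = \<Union>(matched_edges h)"
    unfolding simulates_def by blast
  from assms(1) obtain k where k: "matched_edges h = commits (edges G) k"
    unfolding simulates_def by blast
  with assms(2-4) have "k \<le> j" unfolding commits_def by (auto simp: not_less[symmetric])
  then show sub: "commits (edges G) j \<supseteq> matched_edges h" unfolding k commits_def by force
  from probe_disjoint[OF assms(2)] sub show "e \<inter> taken h = {}"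
    unfolding taken commits_def by blast
qed

lemma finite_neighbors: "finite (neighbors G u)" and not_self_neighbor: "u \<notin> neighbors G u"
proof -
  have "neighbors G u \<subseteq> verts G"
    using G unfolding simple_graph_def neighbors_def by auto
  then show "finite (neighbors G u)"
    using G unfolding simple_graph_def by (auto intro: finite_subset)
  show "u \<notin> neighbors G u"
    using G unfolding simple_graph_def neighbors_def by auto
qed

lemma available_items_subset: "available_items G h \<subseteq> data_items"
  unfolding available_items_def data_items_def using finite_neighbors not_self_neighbor by auto

lemma finite_available_items: "finite (available_items G h)"
  unfolding available_items_def using G unfolding simple_graph_def by auto

text \<open>Both endpoints are still untaken and each lists the other in its data item, so the item
  of either one is a witness.\<close>

lemma new_edge_hit:
  assumes sim: "simulates h" and e: "P (edges G) j = Some e" "e \<in> edges G" "e \<notin> matched_edges h"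
    and eM: "P (matched_edges h) j = Some e"
  shows "\<exists>i\<in>available_items G h. hit (matched_edges h) i j"
proof -
  from card_probe[OF e(1)] obtain x y where xy: "e = {x, y}" by (meson card_2_iff)
  have "x \<notin> taken h" using edge_in_result_untaken(1)[OF sim e] xy by blast
  moreover have "x \<in> verts G" using G e(2) xy unfolding simple_graph_def by auto
  ultimately have "(x, neighbors G x) \<in> available_items G h"
    unfolding available_items_def by blast
  moreover have "hit (matched_edges h) (x, neighbors G x) j"
    unfolding hit_def neighbors_def using eM e(2,3) xy by auto
  ultimately show ?thesis by blast
qed

text \<open>Before the first hit both runs receive the same answers: a probed edge of
  \<open>G\<close> outside the matching would hit an available item, and matched edges lie in
  \<open>G\<close>. Step \<open>k\<close> is included because its probe depends on earlier answers
  only.\<close>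

lemma runs_agree:
  assumes sim: "simulates h"
    and no_hit: "\<And>i j. i \<in> available_items G h \<Longrightarrow> j < k \<Longrightarrow> \<not> hit (matched_edges h) i j"
  shows "j \<le> k \<Longrightarrow> P (edges G) j = P (matched_edges h) j"
proof (induction j rule: less_induct)
  case (less j)
  show ?case
  proof (rule locality)
    fix l e assume l: "l < j" and e: "P (edges G) l = Some e"
    have eM: "P (matched_edges h) l = Some e" using less.IH[OF l] less.prems l e by simp
    have "e \<in> matched_edges h" if "e \<in> edges G"
      using new_edge_hit[OF sim e that _ eM] no_hit l less.prems by (meson less_le_trans)
    moreover have "e \<in> edges G" if "e \<in> matched_edges h"
      using that sim unfolding simulates_def commits_def by blast
    ultimately show "e \<in> edges G \<longleftrightarrow> e \<in> matched_edges h" by blast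
  qed
qed

text \<open>Without any hit the two runs agree forever, so a missing edge of the result would itself
  be a hit.\<close>

lemma matched_edges_eq_result:
  assumes sim: "simulates h"
    and no_hit: "\<And>i j. i \<in> available_items G h \<Longrightarrow> \<not> hit (matched_edges h) i j"
  shows "matched_edges h = result (edges G)"
proof
  show "matched_edges h \<subseteq> result (edges G)"
    using sim commits_subset_result unfolding simulates_def by blast
  show "result (edges G) \<subseteq> matched_edges h"
  proof
    fix e assume "e \<in> result (edges G)"
    then obtain j where e: "e \<in> edges G" "P (edges G) j = Some e" unfolding result_def by blast
    moreover have "P (matched_edges h) j = Some e"
      using runs_agree[OF sim no_hit, of j j] e by simp
    ultimately show "e \<in> matched_edges h" using new_edge_hit[OF sim] no_hit by blast
  qed
qed

lemma simulates_step:
  assumes sim: "simulates h" and ne: "available_items G h \<noteq> {}"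
    and i: "i = first_item (ordering simulation h) (available_items G h)"
  shows "simulates (h @ [(i, decision simulation h i)])"
proof -
  let ?M = "matched_edges h" and ?S = "available_items G h"
  have iS: "i \<in> ?S" and first: "\<And>j. j \<in> ?S \<Longrightarrow> (i, j) \<in> ordering simulation h"
    using first_item[OF linear_order_simulation finite_available_items ne available_items_subset]
    unfolding i by blast+
  from iS obtain u where u: "i = (u, neighbors G u)" "u \<in> verts G" "u \<notin> taken h"
    unfolding available_items_def by blast
  have rank_min: "hit_rank ?M i \<le> hit_rank ?M j" if "j \<in> ?S" for j
    using first[OF that] unfolding simulation_def by auto
  show ?thesis
  proof (cases "hit_rank ?M i")
    \<comment> \<open>By minimality no available item is hit before step \<open>k\<close>, so the
      probe that hits \<open>i\<close> on the matched edges also occurs on \<open>G\<close>.\<close>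
    case (enat k)
    have no_hit: "\<not> hit ?M j l" if "j \<in> ?S" "l < k" for j l
      using rank_min[OF that(1)] hit_rank_le[of ?M j l] that(2) enat
      by (metis enat_ord_simps(2) leD order_trans)
    from hit_rank_eq_enatD[OF enat] u obtain v where
      v: "v \<in> neighbors G u" "P ?M k = Some {u, v}" "{u, v} \<notin> ?M"
      unfolding hit_def by auto
    have agree: "\<And>j. j \<le> k \<Longrightarrow> P (edges G) j = P ?M j" by (rule runs_agree[OF sim no_hit])
    have edge: "P (edges G) k = Some {u, v}" "{u, v} \<in> edges G"
      using agree[of k] v unfolding neighbors_def by simp_all
    note untaken = edge_in_result_untaken[OF sim edge v(3)]
    have "partner h i v" unfolding partner_def using v(1,2) u(1) untaken(1) enat by simp
    \<comment> \<open>The probed pair contains \<open>u\<close>, which determines its other member,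
      so \<open>SOME\<close> can only return \<open>v\<close>.\<close>
    moreover have "w = v" if "partner h i w" for w
      using that v(2) enat u(1) unfolding partner_def by (simp add: doubleton_eq_iff) metis
    ultimately have "\<exists>v. partner h i v" "(SOME v. partner h i v) = v"
      by (blast, intro some_equality)
    then have dec: "decision simulation h i = Some v"
      unfolding simulation_def by simp
    have M': "matched_edges (h @ [(i, Some v)]) = insert {u, v} ?M"
      unfolding matched_edges_def u(1) by auto
    \<comment> \<open>No edge was skipped: one committed before step \<open>k\<close> but missing
      from the matching would have caused an earlier hit.\<close>
    have "commits (edges G) k \<subseteq> ?M"
    proof
      fix e assume "e \<in> commits (edges G) k"
      then obtain j where j: "j < k" "P (edges G) j = Some e" "e \<in> edges G"
        unfolding commits_def by blast
      moreover have "P ?M j = Some e" using agree[of j] j by simp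
      ultimately show "e \<in> ?M" using new_edge_hit[OF sim] no_hit by blast
    qed
    with untaken(2) have "commits (edges G) k = ?M" by blast
    then have "commits (edges G) (Suc k) = insert {u, v} ?M"
      using edge unfolding commits_def by (auto simp: less_Suc_eq)
    \<comment> \<open>The result contains an edge not yet matched, so no node has been isolated so
      far.\<close>
    moreover have "{u, v} \<in> result (edges G)" using edge unfolding result_def by blast
    then have "taken h = \<Union>?M" using sim v(3) unfolding simulates_def by blast
    then have "taken (h @ [(i, Some v)]) = \<Union>(insert {u, v} ?M)"
      unfolding taken_def u(1) by auto
    ultimately have "insert {u, v} ?M = commits (edges G) (Suc k)"
      "taken (h @ [(i, Some v)]) = \<Union>(insert {u, v} ?M)" by simp_all
    then show ?thesis unfolding simulates_def dec M' by blast
  next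
    \<comment> \<open>No available item is ever hit, so the result is complete and isolating
      \<open>i\<close> loses no edge.\<close>
    case infinity
    have "\<not> hit ?M j l" if "j \<in> ?S" for j l
      using rank_min[OF that] hit_rank_le[of ?M j l] infinity by auto
    then have "?M = result (edges G)" by (rule matched_edges_eq_result[OF sim])
    moreover have "decision simulation h i = None"
      unfolding simulation_def by (simp add: partner_def infinity)
    moreover have "matched_edges (h @ [(i, None)]) = ?M"
      unfolding matched_edges_def by auto
    ultimately show ?thesis using sim unfolding simulates_def by simp
  qed
qed

lemma simulates_priority_run: "simulates (priority_run simulation G n)"
proof (induction n)
  case 0
  have "commits (edges G) 0 = {}" "matched_edges [] = {}" "taken ([] :: 'v priority_history) = {}"
    unfolding commits_def matched_edges_def taken_def by auto
  then show ?case unfolding simulates_def by auto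
next
  case (Suc n)
  then show ?case using simulates_step by (simp add: Let_def)
qed

text \<open>Each round takes at least the node of its item, so the number of untaken nodes strictly
  decreases while items are available.\<close>

lemma priority_run_exhausts:
  "available_items G (priority_run simulation G n) = {} \<or>
   n + card (verts G - taken (priority_run simulation G n)) \<le> card (verts G)"
proof (induction n)
  case 0
  then show ?case by (simp add: taken_def)
next
  case (Suc n)
  let ?h = "priority_run simulation G n"
  let ?i = "first_item (ordering simulation ?h) (available_items G ?h)"
  show ?case
  proof (cases "available_items G ?h = {}")
    case True
    then show ?thesis by simp
  next
    case False
    have "?i \<in> available_items G ?h"
      using first_item(1)[OF linear_order_simulation finite_available_items False
          available_items_subset] .
    then obtain u where u: "?i = (u, neighbors G u)" "u \<in> verts G" "u \<notin> taken ?h"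
      unfolding available_items_def by blast
    have run: "priority_run simulation G (Suc n) = ?h @ [(?i, decision simulation ?h ?i)]"
      using False by (simp add: Let_def)
    have "verts G - taken (priority_run simulation G (Suc n)) \<subset> verts G - taken ?h"
      using u unfolding run taken_def by auto
    then have "card (verts G - taken (priority_run simulation G (Suc n))) < card (verts G - taken ?h)"
      using G unfolding simple_graph_def by (intro psubset_card_mono) auto
    with Suc False show ?thesis by simp
  qed
qed

lemma priority_output_simulation: "priority_output simulation G = result (edges G)"
proof -
  have union: "priority_output simulation G = (\<Union>n. matched_edges (priority_run simulation G n))"
    unfolding priority_output_def matched_edges_def ..
  have "matched_edges (priority_run simulation G n) \<subseteq> result (edges G)" for n
    using simulates_priority_run commits_subset_result unfolding simulates_def by metis
  \<comment> \<open>With one round more than there are nodes the counting bound fails. No item is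
    then available, and the absence of hits is vacuous.\<close>
  moreover have "available_items G (priority_run simulation G (Suc (card (verts G)))) = {}"
    using priority_run_exhausts[of "Suc (card (verts G))"] by simp
  then have "matched_edges (priority_run simulation G (Suc (card (verts G)))) = result (edges G)"
    by (intro matched_edges_eq_result simulates_priority_run) blast
  ultimately show ?thesis unfolding union by blast
qed

end

end

text \<open>The simulation is applied seed by seed over the same space \<open>M\<close>. The outputs
  agree for every seed, so measurability and distribution carry over.\<close>

lemma randomized_priority_simulation:
  fixes out :: "'c \<Rightarrow> 'v graph \<Rightarrow> 'v set set" and P :: "'c \<Rightarrow> 'v set set \<Rightarrow> nat \<Rightarrow> 'v set option"
  assumes A: "randomized legal out M A"
    and P: "\<And>a. legal a \<Longrightarrow> probe_process (P a)"
    and out: "\<And>a G. legal a \<Longrightarrow> out a G = probe_process.result (P a) (edges G)"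
  shows "\<exists>B. randomized_priority M B \<and>
    (\<forall>G. simple_graph G \<longrightarrow> output_distribution priority_output M B G = output_distribution out M A G)"
proof (intro exI conjI allI impI)
  let ?B = "\<lambda>r. probe_process.simulation (P (A r))"
  have process: "probe_process (P (A r))" if "r \<in> space M" for r
    using A P that unfolding randomized_def by blast
  have same: "priority_output (?B r) G = out (A r) G" if "r \<in> space M" "simple_graph G" for r G
    using probe_process.priority_output_simulation[OF process that(2)] out A that(1)
    unfolding randomized_def by simp
  then have "(\<lambda>r. priority_output (?B r) G) \<in> measurable M (count_space UNIV)"
    if "simple_graph G" for G
    using A that unfolding randomized_def by (subst measurable_cong[of _ _ "\<lambda>r. out (A r) G"]) auto
  with A process probe_process.priority_legal_simulation show "randomized_priority M ?B"
    unfolding randomized_def by blast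
  show "output_distribution priority_output M ?B G = output_distribution out M A G"
    if "simple_graph G" for G
    unfolding output_distribution_def using same that by (intro distr_cong) auto
qed


section \<open>Query and vertex iterative algorithms as probe processes\<close>

text \<open>Runs depend on the edges of the graph only, so the node set may be chosen arbitrarily.\<close>

definition query_probe :: "'v query_algorithm \<Rightarrow> 'v set set \<Rightarrow> nat \<Rightarrow> 'v set option" where
  "query_probe A E k = A (query_run A \<lparr>verts = {}, edges = E\<rparr> k)"

lemma query_run_cong: "edges G = edges H \<Longrightarrow> query_run A G n = query_run A H n"
  by (induction n) (auto simp: Let_def split: option.splits)

lemma committed_query_run:
  "committed (query_run A G k) = {e \<in> edges G. \<exists>j<k. query_probe A (edges G) j = Some e}"
proof (induction k)
  case 0
  then show ?case by (simp add: committed_def)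
next
  case (Suc k)
  have "query_run A \<lparr>verts = {}, edges = edges G\<rparr> k = query_run A G k" by (rule query_run_cong) simp
  then have "query_probe A (edges G) k = A (query_run A G k)"
    unfolding query_probe_def by simp
  with Suc show ?case
    by (auto simp: committed_def Let_def less_Suc_eq split: option.splits)
qed

text \<open>Equal answers yield equal transcripts, hence locality. Successful probes enter
  \<open>committed\<close>, and legality keeps later probes disjoint from it.\<close>

lemma query_probe_process:
  assumes A: "query_legal A"
  shows "probe_process (query_probe A)"
proof
  fix k E F
  assume same: "\<And>j e. j < k \<Longrightarrow> query_probe A E j = Some e \<Longrightarrow> e \<in> E \<longleftrightarrow> e \<in> F"
  have "j \<le> k \<Longrightarrow> query_run A \<lparr>verts = {}, edges = E\<rparr> j = query_run A \<lparr>verts = {}, edges = F\<rparr> j" for j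
    using same by (induction j) (auto simp: Let_def query_probe_def Suc_le_eq split: option.splits)
  then show "query_probe A E k = query_probe A F k" unfolding query_probe_def by simp
next
  fix E k e assume e: "query_probe A E k = Some e"
  then show "card e = 2" using A unfolding query_legal_def query_probe_def by blast
  fix j e' assume "j < k" "query_probe A E j = Some e'" "e' \<in> E"
  then have "e' \<in> committed (query_run A \<lparr>verts = {}, edges = E\<rparr> k)"
    unfolding committed_query_run by auto
  with A e show "e \<inter> e' = {}" unfolding query_legal_def query_probe_def by blast
qed

lemma query_output_eq_result:
  "query_legal A \<Longrightarrow> query_output A G = probe_process.result (query_probe A) (edges G)"
  unfolding query_output_def committed_query_run
  by (subst probe_process.result_def[OF query_probe_process]) auto

text \<open>Picks and isolations become silent steps \<open>None\<close>, after which probing may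
  resume.\<close>

definition vi_probe :: "'v vi_algorithm \<Rightarrow> 'v set set \<Rightarrow> nat \<Rightarrow> 'v set option" where
  "vi_probe A E k = (let h = vi_run A \<lparr>verts = {}, edges = E\<rparr> k in
     case A h of Some (Scan v) \<Rightarrow> Some {the (current (vi_state h)), v} | _ \<Rightarrow> None)"

lemma vi_answer_cong: "edges G = edges H \<Longrightarrow> vi_answer s G m = vi_answer s H m"
  by (cases m) auto

lemma vi_run_cong: "edges G = edges H \<Longrightarrow> vi_run A G n = vi_run A H n"
  by (induction n) (auto simp: Let_def vi_answer_cong[of G H] split: option.splits)

lemma vi_state_snoc: "vi_state (h @ [x]) = vi_update x (vi_state h)"
  unfolding vi_state_def by simp

lemma matching_vi_run:
  "matching (vi_state (vi_run A G k)) = {e \<in> edges G. \<exists>j<k. vi_probe A (edges G) j = Some e}"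
proof (induction k)
  case 0
  then show ?case by (simp add: vi_state_def)
next
  case (Suc k)
  have "vi_run A \<lparr>verts = {}, edges = edges G\<rparr> k = vi_run A G k" by (rule vi_run_cong) simp
  then have "matching (vi_state (vi_run A G (Suc k))) =
      matching (vi_state (vi_run A G k)) \<union> {e \<in> edges G. vi_probe A (edges G) k = Some e}"
    by (auto simp: Let_def vi_state_snoc vi_probe_def split: option.split vi_move.split)
  with Suc show ?case
    by (auto simp del: vi_run.simps simp: less_Suc_eq)
qed

text \<open>Legality of \<open>Scan v\<close> asks only \<open>v\<close> to be free, whereas
  disjoint probes need this of the current vertex too. \<open>Pick\<close> checks it, and a
  successful scan or an isolation clears \<open>current\<close>.\<close>

lemma current_not_taken:
  assumes A: "vi_legal A"
  shows "current (vi_state (vi_run A G k)) = Some u \<Longrightarrow> u \<notin> vi_taken (vi_state (vi_run A G k))"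
proof (induction k arbitrary: u)
  case 0
  then show ?case by (simp add: vi_state_def)
next
  case (Suc k)
  let ?h = "vi_run A G k"
  show ?case
  proof (cases "A ?h")
    case None
    with Suc show ?thesis by simp
  next
    case (Some m)
    with A have legal: "vi_legal_move (vi_state ?h) m" unfolding vi_legal_def by blast
    show ?thesis
      using Suc Some legal by (cases m) (auto simp: Let_def vi_state_snoc vi_taken_def split: if_splits)
  qed
qed

lemma vi_probe_process:
  assumes A: "vi_legal A"
  shows "probe_process (vi_probe A)"
proof
  fix k E F
  assume same: "\<And>j e. j < k \<Longrightarrow> vi_probe A E j = Some e \<Longrightarrow> e \<in> E \<longleftrightarrow> e \<in> F"
  have "j \<le> k \<Longrightarrow> vi_run A \<lparr>verts = {}, edges = E\<rparr> j = vi_run A \<lparr>verts = {}, edges = F\<rparr> j" for j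
  proof (induction j)
    case (Suc j)
    then have IH: "vi_run A \<lparr>verts = {}, edges = E\<rparr> j = vi_run A \<lparr>verts = {}, edges = F\<rparr> j" by simp
    show ?case
    proof (cases "A (vi_run A \<lparr>verts = {}, edges = E\<rparr> j)")
      case None
      with IH show ?thesis by simp
    next
      case (Some m)
      with IH Suc.prems same[of j] show ?thesis
        by (cases m) (auto simp: Let_def vi_probe_def)
    qed
  qed simp
  then show "vi_probe A E k = vi_probe A F k" unfolding vi_probe_def by simp
next
  fix E k e assume e: "vi_probe A E k = Some e"
  let ?h = "vi_run A \<lparr>verts = {}, edges = E\<rparr> k"
  from e obtain v where v: "A ?h = Some (Scan v)" "e = {the (current (vi_state ?h)), v}"
    unfolding vi_probe_def by (auto simp: Let_def split: option.splits vi_move.splits)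
  with A have "vi_legal_move (vi_state ?h) (Scan v)" unfolding vi_legal_def by blast
  then obtain u where u: "current (vi_state ?h) = Some u" "v \<noteq> u" "v \<notin> vi_taken (vi_state ?h)" by auto
  with v show "card e = 2" by auto
  fix j e' assume "j < k" "vi_probe A E j = Some e'" "e' \<in> E"
  then have "e' \<in> matching (vi_state ?h)" unfolding matching_vi_run by auto
  moreover have "u \<notin> vi_taken (vi_state ?h)" using current_not_taken[OF A u(1)] .
  ultimately show "e \<inter> e' = {}" using u v unfolding vi_taken_def by auto
qed

lemma vi_output_eq_result:
  "vi_legal A \<Longrightarrow> vi_output A G = probe_process.result (vi_probe A) (edges G)"
  unfolding vi_output_def matching_vi_run
  by (subst probe_process.result_def[OF vi_probe_process]) auto


section \<open>MinGreedy on paths\<close>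

text \<open>The remaining nodes of \<open>V\<close> are isolated, so all these paths share one node
  set.\<close>

definition path4 :: "'v set \<Rightarrow> 'v \<Rightarrow> 'v \<Rightarrow> 'v \<Rightarrow> 'v \<Rightarrow> 'v graph" where
  "path4 V a b c d = \<lparr>verts = V, edges = {{a, b}, {b, c}, {c, d}}\<rparr>"

lemma simple_path4:
  assumes "finite V" "{a, b, c, d} \<subseteq> V" "distinct [a, b, c, d]"
  shows "simple_graph (path4 V a b c d)"
  using assms unfolding simple_graph_def path4_def by auto

text \<open>The inner nodes have degree two and the ends degree one, so the first edge picked is an
  end edge.\<close>

lemma mingreedy_path4:
  assumes V: "finite V" "{a, b, c, d} \<subseteq> V" and dist: "distinct [a, b, c, d]"
    and X: "X \<in> set_pmf (mingreedy (path4 V a b c d))"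
  shows "{a, b} \<in> X \<or> {c, d} \<in> X"
proof -
  let ?G = "path4 V a b c d"
  have G: "simple_graph ?G" by (rule simple_path4[OF V dist])
  have ne: "edges ?G \<noteq> {}" unfolding path4_def by simp
  have nb: "neighbors ?G a = {b}" "neighbors ?G b = {a, c}" "neighbors ?G c = {b, d}"
    "neighbors ?G d = {c}"
    using dist unfolding neighbors_def path4_def by (auto simp: doubleton_eq_iff)
  have nodes: "\<Union>(edges ?G) = {a, b, c, d}" unfolding path4_def by auto
  have min: "min_degree_nodes ?G \<subseteq> {a, d}"
    using dist unfolding min_degree_nodes_def nodes by (auto simp: node_degree_def nb)
  \<comment> \<open>One unfolding suffices, since later rounds only insert further edges.\<close>
  from X obtain u v where u: "u \<in> set_pmf (pmf_of_set (min_degree_nodes ?G))"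
    and v: "v \<in> set_pmf (pmf_of_set (neighbors ?G u))" and uv: "{u, v} \<in> X"
    by (subst (asm) mingreedy.simps) (auto simp: G ne)
  from u min have "u \<in> {a, d}"
    using set_pmf_of_set[OF min_degree_nodes_finite_nonempty(2,1)[OF G ne]] by blast
  then show ?thesis
  proof
    assume "u = a"
    with v uv show ?thesis by (simp add: nb pmf_of_set_singleton)
  next
    assume "u \<in> {d}"
    with v uv show ?thesis by (simp add: nb pmf_of_set_singleton insert_commute)
  qed
qed

text \<open>Probes leaving \<open>V\<close> fail on every graph with nodes \<open>V\<close>, so the
  run on \<open>{}\<close> determines the first probe inside \<open>V\<close> for all paths at once.
  A path with that pair in the middle commits it, which blocks both end edges.\<close>

lemma (in probe_process) unlucky_path:
  assumes V: "finite V" "card V \<ge> 4"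
  shows "\<exists>a b c d. {a, b, c, d} \<subseteq> V \<and> distinct [a, b, c, d] \<and>
    \<not> ({a, b} \<in> result (edges (path4 V a b c d)) \<or> {c, d} \<in> result (edges (path4 V a b c d)))"
proof (rule ccontr)
  assume "\<not> ?thesis"
  then have lucky: "{a, b} \<in> result (edges (path4 V a b c d)) \<or> {c, d} \<in> result (edges (path4 V a b c d))"
    if "{a, b, c, d} \<subseteq> V" "distinct [a, b, c, d]" for a b c d
    using that by blast
  \<comment> \<open>Here four nodes are needed: two besides \<open>b\<close> and \<open>c\<close> to
    serve as ends.\<close>
  have extend: "\<exists>a d. {a, b, c, d} \<subseteq> V \<and> distinct [a, b, c, d]" if bc: "b \<in> V" "c \<in> V" "b \<noteq> c" for b c
  proof -
    have "card (V - {b, c}) \<ge> 2" using V bc by (simp add: card_Diff_subset)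
    then obtain T where T: "T \<subseteq> V - {b, c}" "card T = 2" by (meson obtain_subset_with_card_n)
    from T(2) obtain a d where "T = {a, d}" "a \<noteq> d" by (meson card_2_iff)
    with T(1) bc show ?thesis by (intro exI[of _ a] exI[of _ d]) auto
  qed
  have inside: "e \<subseteq> V" if "e \<in> edges (path4 V a b c d)" "{a, b, c, d} \<subseteq> V" for a b c d e
    using that by (auto simp: path4_def)
  let ?first = "\<lambda>k. \<exists>e\<subseteq>V. P {} k = Some e"
  have "\<exists>k. ?first k"
  proof (rule ccontr)
    \<comment> \<open>If no probe ever lay inside \<open>V\<close>, the run on a path would equal
      the run on \<open>{}\<close> and commit nothing.\<close>
    assume none: "\<not> ?thesis"
    have "2 \<le> card V" using V(2) by simp
    then obtain T where T: "T \<subseteq> V" "card T = 2" by (meson obtain_subset_with_card_n)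
    from T(2) obtain b c where "T = {b, c}" "b \<noteq> c" by (meson card_2_iff)
    with T(1) extend[of b c] obtain a d where abcd: "{a, b, c, d} \<subseteq> V" "distinct [a, b, c, d]" by blast
    let ?E = "edges (path4 V a b c d)"
    have same: "P {} k = P ?E k" for k
      using none inside[OF _ abcd(1)] by (intro locality) blast
    from lucky[OF abcd] obtain e k where "e \<in> ?E" "P ?E k = Some e"
      unfolding result_def by blast
    with inside[OF _ abcd(1)] same[of k] none show False by auto
  qed
  define k where "k = (LEAST k. ?first k)"
  from LeastI_ex[OF \<open>\<exists>k. ?first k\<close>] obtain e where e: "e \<subseteq> V" "P {} k = Some e"
    unfolding k_def by blast
  have before: "\<not> ?first j" if "j < k" for j using not_less_Least that unfolding k_def by blast
  from card_probe[OF e(2)] obtain b c where bc: "e = {b, c}" "b \<noteq> c" by (meson card_2_iff)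
  with e extend[of b c] obtain a d where abcd: "{a, b, c, d} \<subseteq> V" "distinct [a, b, c, d]" by blast
  let ?E = "edges (path4 V a b c d)"
  \<comment> \<open>All probes before \<open>k\<close> leave \<open>V\<close>, so they are edges in
    neither set.\<close>
  have "P {} k = P ?E k"
    using before inside[OF _ abcd(1)] by (intro locality) blast
  with e bc have "{b, c} \<in> result ?E" unfolding result_def by (auto simp: path4_def)
  then have "{a, b} \<notin> result ?E" "{c, d} \<notin> result ?E"
    using abcd(2) result_disjoint[of "{b, c}" ?E "{a, b}"] result_disjoint[of "{b, c}" ?E "{c, d}"]
    by (auto simp: doubleton_eq_iff)
  with lucky[OF abcd] show False by blast
qed

lemma (in prob_space) AE_witness:
  assumes "AE x in M. Q x"
  shows "\<exists>x\<in>space M. Q x"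
proof (rule ccontr)
  assume none: "\<not> ?thesis"
  from AE_space assms have "AE x in M. False" by eventually_elim (use none in blast)
  then show False by simp
qed

text \<open>For each path almost every seed yields an end edge. There are finitely many paths on
  \<open>V\<close>, so one seed succeeds on all of them, contradicting the deterministic bound
  \<open>unlucky_path\<close>.\<close>

lemma mingreedy_not_query:
  assumes V: "finite V" "card V \<ge> 4" and A: "randomized_query M A"
    and mg: "\<And>G. simple_graph G \<Longrightarrow> verts G = V \<Longrightarrow>
      output_distribution query_output M A G = measure_pmf (mingreedy G)"
  shows False
proof -
  interpret prob_space M using A unfolding randomized_def by blast
  let ?good = "\<lambda>(a, b, c, d) r. {a, b} \<in> query_output (A r) (path4 V a b c d) \<or>
    {c, d} \<in> query_output (A r) (path4 V a b c d)"
  let ?I = "{(a, b, c, d). {a, b, c, d} \<subseteq> V \<and> distinct [a, b, c, d]}"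
  have "?I \<subseteq> V \<times> V \<times> V \<times> V" by auto
  then have "finite ?I" by (rule finite_subset) (simp add: V)
  moreover have "AE r in M. ?good p r" if p: "p \<in> ?I" for p
  proof -
    obtain a b c d where abcd: "p = (a, b, c, d)" "{a, b, c, d} \<subseteq> V" "distinct [a, b, c, d]"
      using p by auto
    let ?G = "path4 V a b c d"
    have G: "simple_graph ?G" by (rule simple_path4[OF V(1) abcd(2,3)])
    have "verts ?G = V" unfolding path4_def by simp
    have "AE X in output_distribution query_output M A ?G. {a, b} \<in> X \<or> {c, d} \<in> X"
      unfolding mg[OF G \<open>verts ?G = V\<close>] AE_measure_pmf_iff
      using mingreedy_path4[OF V(1) abcd(2,3)] by blast
    then show ?thesis
      \<comment> \<open>Measurability of the output pulls the almost sure property back from the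
        output distribution to the seeds.\<close>
      unfolding output_distribution_def using A G abcd(1)
      by (subst (asm) AE_distr_iff) (auto simp: randomized_def)
  qed
  ultimately have "AE r in M. \<forall>p\<in>?I. ?good p r" by (intro AE_finite_allI)
  from AE_witness[OF this] obtain r where r: "r \<in> space M" "\<forall>p\<in>?I. ?good p r" by (elim bexE)
  from A r(1) have legal: "query_legal (A r)" unfolding randomized_def by blast
  from probe_process.unlucky_path[OF query_probe_process[OF legal] V] obtain a b c d where
    abcd: "(a, b, c, d) \<in> ?I" and unlucky:
      "\<not> ({a, b} \<in> query_output (A r) (path4 V a b c d) \<or>
        {c, d} \<in> query_output (A r) (path4 V a b c d))"
    unfolding query_output_eq_result[OF legal] by blast
  from bspec[OF r(2) abcd] unlucky show False by simp
qed

text \<open>Fixing \<open>V\<close> strengthens the negative part: even an algorithm tailored to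
  \<open>V\<close> and compared with MinGreedy only on graphs with that node set fails.\<close>

theorem theorem7:
  shows
    "(\<forall>(M :: 'r measure) (A :: 'r \<Rightarrow> 'v query_algorithm).
        randomized_query M A \<longrightarrow>
        (\<exists>B :: 'r \<Rightarrow> 'v priority_algorithm.
           randomized_priority M B \<and>
           (\<forall>G. simple_graph G \<longrightarrow>
              output_distribution priority_output M B G =
              output_distribution query_output M A G)))
     \<and>
     (\<forall>(M :: 'r measure) (A :: 'r \<Rightarrow> 'v vi_algorithm).
        randomized_vi M A \<longrightarrow>
        (\<exists>B :: 'r \<Rightarrow> 'v priority_algorithm.
           randomized_priority M B \<and>
           (\<forall>G. simple_graph G \<longrightarrow>
              output_distribution priority_output M B G =
              output_distribution vi_output M A G)))
     \<and>
     (\<forall>V :: 'v set. finite V \<and> card V \<ge> 4 \<longrightarrow>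
        \<not> (\<exists>(M :: 'r measure) (A :: 'r \<Rightarrow> 'v query_algorithm).
             randomized_query M A \<and>
             (\<forall>G. simple_graph G \<and> verts G = V \<longrightarrow>
                output_distribution query_output M A G = measure_pmf (mingreedy G))))"
proof (intro conjI allI impI)
  show "\<exists>B :: 'r \<Rightarrow> 'v priority_algorithm. randomized_priority M B \<and>
      (\<forall>G. simple_graph G \<longrightarrow>
        output_distribution priority_output M B G = output_distribution query_output M A G)"
    if "randomized_query M A" for M :: "'r measure" and A :: "'r \<Rightarrow> 'v query_algorithm"
    using randomized_priority_simulation[OF that query_probe_process query_output_eq_result] .
  show "\<exists>B :: 'r \<Rightarrow> 'v priority_algorithm. randomized_priority M B \<and>
      (\<forall>G. simple_graph G \<longrightarrow>
        output_distribution priority_output M B G = output_distribution vi_output M A G)"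
    if "randomized_vi M A" for M :: "'r measure" and A :: "'r \<Rightarrow> 'v vi_algorithm"
    using randomized_priority_simulation[OF that vi_probe_process vi_output_eq_result] .
  show "\<not> (\<exists>(M :: 'r measure) (A :: 'r \<Rightarrow> 'v query_algorithm). randomized_query M A \<and>
      (\<forall>G. simple_graph G \<and> verts G = V \<longrightarrow>
        output_distribution query_output M A G = measure_pmf (mingreedy G)))"
    if "finite V \<and> card V \<ge> 4" for V :: "'v set"
    using mingreedy_not_query[of V] that by blast
qed

end
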